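(* Let $v\ge 2$, $s_1\ge \dots\ge s_v\ge 1$ be integers, $\mathbf s=(s_1,\dots,s_v)$, $c=\Sigma(\mathbf s)$, and $m\le c$. Consider the problem of minimizing the probability of winning the $m$-round $\mathbf s$-game over all (adaptive) strategies. The minimum probability of winning is $0$ if and only if the initial position is decided (that is, if $m>c-s_1$). Moreover, the strategies that surely lose are precisely those strategies for which a position that is undecided can never appear. If $m\le c-s_1$, then the smallest probability of winning is $\prod_{i=0}^{m-1}\frac{c-s_1-i}{c-i}$, and all strategies achieving it are anti-greedy, i.e. they always name a value that is most frequent among the remaining cards (equivalently, a value that occurs $s_1$ times in the remaining deck).
   Context: For a vector $\mathbf s=(s_1,\dots,s_v)$ of non-negative integers, the $\mathbf s$-deck consists of $s_i$ cards of Value $i$; $\Sigma(\mathbf s)=s_1+\dots+s_v$. In the $m$-round $\mathbf s$-game, the deck is shuffled uniformly at random; in each of $m$ rounds the player names a value in $\{1,\dots,v\}$ and then the top card of the remaining deck is turned face up. The player loses if in at least one round the turned card has the named value, and wins otherwise. Bids may depend on previously turned cards. A situation in the game, when the player is about to name a bid, is called decided if $m'>s_1'+\dots+s_v'-\max(s_1',\dots,s_v')$, where $s_i'$ is the number of remaining cards of Value $i$ and $m'$ is the number of remaining rounds; otherwise it is undecided.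
   Formalization: Play is taken to stop at the first hit, so only positions before a loss count as appearing (also for "always name"), and the end of a won play (no rounds left, hence undecided) counts as a position; otherwise the sure-loss claim fails, e.g. s=(1,1), m=2, bidding 1 then 2. *)

theory Defs
  imports "HOL-Probability.Probability" "HOL-Combinatorics.Multiset_Permutations"
begin

text \<open>
  A vector \<open>(s\<^sub>1, \<dots>, s\<^sub>v)\<close> is a function \<open>s\<close> of which only the values on \<open>{1..v}\<close> matter.
  The \<open>s i\<close> physical cards of Value \<open>i\<close> are the pairs \<open>(i, j)\<close> with \<open>j < s i\<close>; all orders of
  these cards are equally likely, but only the values of the cards are visible.
\<close>

definition cards :: "nat \<Rightarrow> (nat \<Rightarrow> nat) \<Rightarrow> (nat \<times> nat) set" where
  "cards v s = (SIGMA i:{1..v}. {..<s i})"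

definition shuffled_deck :: "nat \<Rightarrow> (nat \<Rightarrow> nat) \<Rightarrow> nat list pmf" where
  "shuffled_deck v s = map_pmf (map fst) (pmf_of_set (permutations_of_set (cards v s)))"

text \<open>A strategy maps the list of values turned so far, in the order of turning, to a bid.\<close>

definition strategies :: "nat \<Rightarrow> (nat list \<Rightarrow> nat) set" where
  "strategies v = {\<sigma>. \<forall>h. \<sigma> h \<in> {1..v}}"

text \<open>No hit in the first \<open>k\<close> rounds when the deck, top card first, is \<open>d\<close>.\<close>

definition survives :: "(nat list \<Rightarrow> nat) \<Rightarrow> nat \<Rightarrow> nat list \<Rightarrow> bool" where
  "survives \<sigma> k d \<longleftrightarrow> (\<forall>j<k. d ! j \<noteq> \<sigma> (take j d))"

definition win_prob :: "nat \<Rightarrow> (nat \<Rightarrow> nat) \<Rightarrow> nat \<Rightarrow> (nat list \<Rightarrow> nat) \<Rightarrow> real" where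
  "win_prob v s m \<sigma> = measure_pmf.prob (shuffled_deck v s) {d. survives \<sigma> m d}"

definition surely_loses :: "nat \<Rightarrow> (nat \<Rightarrow> nat) \<Rightarrow> nat \<Rightarrow> (nat list \<Rightarrow> nat) \<Rightarrow> bool" where
  "surely_loses v s m \<sigma> \<longleftrightarrow> (\<forall>d\<in>set_pmf (shuffled_deck v s). \<not> survives \<sigma> m d)"

definition is_min_win_prob :: "nat \<Rightarrow> (nat \<Rightarrow> nat) \<Rightarrow> nat \<Rightarrow> real \<Rightarrow> bool" where
  "is_min_win_prob v s m p \<longleftrightarrow>
     (\<exists>\<sigma>\<in>strategies v. win_prob v s m \<sigma> = p) \<and> (\<forall>\<sigma>\<in>strategies v. p \<le> win_prob v s m \<sigma>)"

definition max_count :: "nat \<Rightarrow> (nat \<Rightarrow> nat) \<Rightarrow> nat" where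
  "max_count v s = Max (s ` {1..v})"

definition decided :: "nat \<Rightarrow> (nat \<Rightarrow> nat) \<Rightarrow> nat \<Rightarrow> bool" where
  "decided v s m \<longleftrightarrow> m > (\<Sum>i=1..v. s i) - max_count v s"

text \<open>
  The play stops at the first hit, so the situations that can appear are given by the sequences
  of turned values without a hit. The end of a won play (no round left) is included; it is never
  decided. It cannot be left out: in the 2-round game with one card of each of two values, the
  strategy that first bids 1 and then bids 2 wins with probability 1/2, although it only ever
  bids in decided situations.
\<close>

definition histories :: "nat \<Rightarrow> (nat \<Rightarrow> nat) \<Rightarrow> nat \<Rightarrow> (nat list \<Rightarrow> nat) \<Rightarrow> nat list set" where
  "histories v s m \<sigma> =
     {take k d | k d. k \<le> m \<and> d \<in> set_pmf (shuffled_deck v s) \<and> survives \<sigma> k d}"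

definition remaining :: "(nat \<Rightarrow> nat) \<Rightarrow> nat list \<Rightarrow> nat \<Rightarrow> nat" where
  "remaining s h i = s i - count_list h i"

definition undecided_never_appears ::
    "nat \<Rightarrow> (nat \<Rightarrow> nat) \<Rightarrow> nat \<Rightarrow> (nat list \<Rightarrow> nat) \<Rightarrow> bool" where
  "undecided_never_appears v s m \<sigma> \<longleftrightarrow>
     (\<forall>h\<in>histories v s m \<sigma>. decided v (remaining s h) (m - length h))"

definition anti_greedy :: "nat \<Rightarrow> (nat \<Rightarrow> nat) \<Rightarrow> nat \<Rightarrow> (nat list \<Rightarrow> nat) \<Rightarrow> bool" where
  "anti_greedy v s m \<sigma> \<longleftrightarrow>
     (\<forall>h\<in>histories v s m \<sigma>. length h < m \<longrightarrow>
        remaining s h (\<sigma> h) = max_count v (remaining s h))"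

end

theory Submission
  imports Defs
begin

text \<open>
  Condition on the first card. With \<open>c\<close> cards left, of which no value has more than \<open>M\<close>, a bid is
  missed by at least \<open>c - M\<close> cards, and after any of them no value has more than \<open>M\<close> cards among
  the \<open>c - 1\<close> remaining ones. Keeping the bound \<open>M\<close> fixed throughout the game, induction on the
  number of rounds gives the product as a lower bound. It is positive while \<open>m + M \<le> c\<close>, so
  equality forces every bid to have exactly \<open>M\<close> remaining cards. Always bidding Value 1 attains the
  bound.
\<close>

section \<open>The product formula\<close>

text \<open>For \<open>a <= c\<close> and \<open>m <= c\<close>, this is the probability that
  \<open>m\<close> draws without replacement from \<open>c\<close> cards avoid \<open>a\<close>
  fixed ones. With real subtraction, factors beyond \<open>i = c - a\<close> are negative, but the
  product is 0 by then.\<close>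

definition miss_prob :: "nat \<Rightarrow> nat \<Rightarrow> nat \<Rightarrow> real" where
  "miss_prob c a m = (\<Prod>i<m. (real c - real a - real i) / (real c - real i))"

lemma miss_prob_0 [simp]: "miss_prob c a 0 = 1"
  by (simp add: miss_prob_def)

text \<open>Peeling off the first factor shifts the others from \<open>Suc c\<close> to
  \<open>c\<close>. This mirrors a draw that misses the \<open>a\<close> cards: one card and one
  round fewer, the same \<open>a\<close>.\<close>

lemma miss_prob_Suc:
  "miss_prob (Suc c) a (Suc m) = (real (Suc c) - real a) / real (Suc c) * miss_prob c a m"
proof -
  have "(real (Suc c) - real a - real (Suc i)) / (real (Suc c) - real (Suc i))
      = (real c - real a - real i) / (real c - real i)" for i
    by simp
  then show ?thesis
    unfolding miss_prob_def prod.lessThan_Suc_shift by (simp only: o_def) simp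
qed

lemma miss_prob_pos: "m + a \<le> c \<Longrightarrow> miss_prob c a m > 0"
  unfolding miss_prob_def by (intro prod_pos) auto

lemma miss_prob_eq_0: "a \<le> c \<Longrightarrow> c - a < m \<Longrightarrow> miss_prob c a m = 0"
  unfolding miss_prob_def by (rule prod_zero) (auto intro!: bexI[of _ "c - a"])

section \<open>Survival along prefixes of a deck\<close>

lemma survives_0 [simp]: "survives \<sigma> 0 d"
  by (simp add: survives_def)

lemma survives_Suc_Cons:
  "survives \<sigma> (Suc m) (x # d) \<longleftrightarrow> x \<noteq> \<sigma> [] \<and> survives (\<lambda>h. \<sigma> (x # h)) m d"
  unfolding survives_def by (simp add: All_less_Suc2)

text \<open>After the prefix \<open>h\<close>, play goes on with the strategy that has
  \<open>h\<close> in its memory. This allows a surviving continuation to be spliced onto a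
  history.\<close>

lemma survives_append:
  "survives \<sigma> (length h + n) (h @ d) \<longleftrightarrow>
     survives \<sigma> (length h) h \<and> survives (\<lambda>h'. \<sigma> (h @ h')) n d"
proof (induction h arbitrary: \<sigma>)
  case Nil
  then show ?case by simp
next
  case (Cons x h)
  then show ?case by (simp add: survives_Suc_Cons)
qed

lemma survives_take: "k \<le> length d \<Longrightarrow> survives \<sigma> k (take k d) \<longleftrightarrow> survives \<sigma> k d"
  unfolding survives_def by (simp add: min_def)

lemma survives_mono: "survives \<sigma> n d \<Longrightarrow> k \<le> n \<Longrightarrow> survives \<sigma> k d"
  unfolding survives_def by auto

section \<open>Counting the winning orders\<close>

text \<open>The labelling \<open>f\<close> and the card set \<open>A\<close> are arbitrary, so the
  deck after a draw, \<open>A - {x}\<close>, is of the same kind and inductions can run over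
  it.\<close>

definition winning_orders :: "('a \<Rightarrow> nat) \<Rightarrow> 'a set \<Rightarrow> nat \<Rightarrow> (nat list \<Rightarrow> nat) \<Rightarrow> 'a list set" where
  "winning_orders f A m \<sigma> = {p \<in> permutations_of_set A. survives \<sigma> m (map f p)}"

lemma finite_winning_orders [simp]: "finite (winning_orders f A m \<sigma>)"
  unfolding winning_orders_def by simp

lemma card_winning_orders_0:
  "finite A \<Longrightarrow> card (winning_orders f A 0 \<sigma>) = fact (card A)"
  by (simp add: winning_orders_def)

text \<open>Winning orders are sorted by their first card \<open>x\<close>, which has to miss the
  first bid; the strategy for the rest sees \<open>f x\<close> in front of its history.\<close>

lemma card_winning_orders_Suc:
  assumes "finite A" "A \<noteq> {}"
  shows "card (winning_orders f A (Suc m) \<sigma>) =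
    (\<Sum>x\<in>{x\<in>A. f x \<noteq> \<sigma> []}. card (winning_orders f (A - {x}) m (\<lambda>h. \<sigma> (f x # h))))"
proof -
  have "winning_orders f A (Suc m) \<sigma> =
    (\<Union>x\<in>{x\<in>A. f x \<noteq> \<sigma> []}. (#) x ` winning_orders f (A - {x}) m (\<lambda>h. \<sigma> (f x # h)))"
    unfolding winning_orders_def permutations_of_set_nonempty[OF assms(2)]
    by (auto simp: survives_Suc_Cons)
  also have "card \<dots> = (\<Sum>x\<in>{x\<in>A. f x \<noteq> \<sigma> []}.
      card ((#) x ` winning_orders f (A - {x}) m (\<lambda>h. \<sigma> (f x # h))))"
    using assms by (intro card_UN_disjoint) auto
  finally show ?thesis
    by (simp add: card_image)
qed

lemma card_values_Diff_le:
  assumes "finite A" "\<And>i. card {y\<in>A. f y = i} \<le> M"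
  shows "card {y\<in>A - {x}. f y = i} \<le> M"
proof -
  have "card {y\<in>A - {x}. f y = i} \<le> card {y\<in>A. f y = i}"
    using assms(1) by (intro card_mono) auto
  then show ?thesis using assms(2)[of i] by simp
qed

lemma card_missing_values:
  assumes "finite A"
  shows "real (card {x\<in>A. f x \<noteq> b}) = real (card A) - real (card {x\<in>A. f x = b})"
proof -
  have "card A = card {x\<in>A. f x = b} + card {x\<in>A. f x \<noteq> b}"
    using assms by (subst card_Un_disjoint [symmetric]) (auto intro: arg_cong[of _ _ card])
  then show ?thesis by simp
qed

text \<open>Scaled by the number of all orders, the product obeys the recursion of the counts,
  without a denominator.\<close>

lemma fact_miss_prob_Suc:
  "fact (Suc c) * miss_prob (Suc c) a (Suc m) = (real (Suc c) - real a) * (fact c * miss_prob c a m)"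
  unfolding miss_prob_Suc by simp

text \<open>\<open>M\<close> is an upper bound and not the exact maximum, which may drop after a
  draw; so the hypothesis passes to \<open>A - {x}\<close> with the same \<open>M\<close>.\<close>

lemma card_winning_orders_ge:
  assumes "finite A" "\<And>i. card {x\<in>A. f x = i} \<le> M" "m + M \<le> card A"
  shows "fact (card A) * miss_prob (card A) M m \<le> real (card (winning_orders f A m \<sigma>))"
  using assms
proof (induction m arbitrary: A \<sigma>)
  case 0
  then show ?case by (simp add: card_winning_orders_0)
next
  case (Suc m)
  then obtain c where c: "card A = Suc c" by (cases "card A") auto
  define q where "q = fact c * miss_prob c M m"
  have "m + M \<le> c" using Suc.prems c by simp
  then have "q > 0" unfolding q_def using miss_prob_pos by simp
  have "fact (card A) * miss_prob (card A) M (Suc m) = (real (Suc c) - real M) * q"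
    unfolding c q_def by (rule fact_miss_prob_Suc)
  also have "\<dots> \<le> real (card {x\<in>A. f x \<noteq> \<sigma> []}) * q"
    using Suc.prems(2)[of "\<sigma> []"] \<open>q > 0\<close>
    unfolding card_missing_values[OF Suc.prems(1)] c by (intro mult_right_mono) auto
  also have "\<dots> \<le> (\<Sum>x\<in>{x\<in>A. f x \<noteq> \<sigma> []}.
      real (card (winning_orders f (A - {x}) m (\<lambda>h. \<sigma> (f x # h)))))"
  proof (rule sum_bounded_below)
    fix x assume "x \<in> {x\<in>A. f x \<noteq> \<sigma> []}"
    then have "card (A - {x}) = c" using c Suc.prems(1) by simp
    then show "q \<le> real (card (winning_orders f (A - {x}) m (\<lambda>h. \<sigma> (f x # h))))"
      using Suc.IH[of "A - {x}"] card_values_Diff_le[OF Suc.prems(1,2)] Suc.prems(1) \<open>m + M \<le> c\<close>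
      by (simp add: q_def)
  qed
  also have "\<dots> = real (card (winning_orders f A (Suc m) \<sigma>))"
    using Suc.prems c by (subst card_winning_orders_Suc) auto
  finally show ?case .
qed

text \<open>Equality case of the induction step above: from
  \<open>n * q <= card X * q <= sum g X = n * q\<close>, both estimates are tight, the number of
  summands and each summand.\<close>

lemma sum_minimal_imp_eq:
  fixes g :: "'a \<Rightarrow> real"
  assumes "finite X" "\<And>x. x \<in> X \<Longrightarrow> q \<le> g x" "q > 0" "n \<le> real (card X)" "sum g X = n * q"
  shows "real (card X) = n" and "\<And>x. x \<in> X \<Longrightarrow> g x = q"
proof -
  have "real (card X) * q \<le> n * q"
    using sum_bounded_below[of X q g] assms by simp
  then show n: "real (card X) = n" using assms(3,4) by simp
  have "(\<Sum>x\<in>X. g x - q) = 0"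
    using n assms(5) by (simp add: sum_subtractf)
  then have "\<forall>x\<in>X. g x - q = 0"
    by (subst (asm) sum_nonneg_eq_0_iff) (use assms in auto)
  then show "\<And>x. x \<in> X \<Longrightarrow> g x = q" by simp
qed

text \<open>Equality in the lower bound is inherited: it forces the first bid to have exactly
  \<open>M\<close> cards and every continuation after a miss to attain its own bound. The induction
  follows the order \<open>p\<close> along its surviving prefix.\<close>

lemma card_winning_orders_eq_imp_bid:
  assumes "finite A" "\<And>i. card {x\<in>A. f x = i} \<le> M" "m + M \<le> card A"
    and "fact (card A) * miss_prob (card A) M m = real (card (winning_orders f A m \<sigma>))"
    and "k < m" "p \<in> permutations_of_set A" "survives \<sigma> k (map f p)"
  shows "card {x\<in>A. f x = \<sigma> (take k (map f p))}
    - count_list (take k (map f p)) (\<sigma> (take k (map f p))) = M"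
  using assms
proof (induction m arbitrary: A \<sigma> k p)
  case 0
  then show ?case by simp
next
  case (Suc m)
  then obtain c where c: "card A = Suc c" by (cases "card A") auto
  define q where "q = fact c * miss_prob c M m"
  have "m + M \<le> c" using Suc.prems c by simp
  \<comment> \<open>Positivity is what later allows \<open>q\<close> to be cancelled, so that the
    number of missing cards can be read off.\<close>
  then have "q > 0" unfolding q_def using miss_prob_pos by simp
  have card_Diff: "card (A - {x}) = c" if "x \<in> A" for x
    using that c Suc.prems(1) by simp
  let ?X = "{x\<in>A. f x \<noteq> \<sigma> []}"
  let ?g = "\<lambda>x. real (card (winning_orders f (A - {x}) m (\<lambda>h. \<sigma> (f x # h))))"
  have X: "real (card ?X) = real (Suc c) - real (card {x\<in>A. f x = \<sigma> []})"
    using card_missing_values[OF Suc.prems(1), of f "\<sigma> []"] unfolding c .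
  have "sum ?g ?X = real (card (winning_orders f A (Suc m) \<sigma>))"
    using Suc.prems c by (subst card_winning_orders_Suc) auto
  also have "\<dots> = (real (Suc c) - real M) * q"
    using Suc.prems(4) unfolding c q_def fact_miss_prob_Suc by simp
  finally have sum: "sum ?g ?X = (real (Suc c) - real M) * q" .
  have ge: "q \<le> ?g x" if "x \<in> ?X" for x
    using card_winning_orders_ge[of "A - {x}" f M m] that card_Diff[of x]
      card_values_Diff_le[OF Suc.prems(1,2)] Suc.prems(1) \<open>m + M \<le> c\<close>
    by (simp add: q_def)
  have le: "real (Suc c) - real M \<le> real (card ?X)"
    unfolding X using Suc.prems(2)[of "\<sigma> []"] by simp
  have fin: "finite ?X" using Suc.prems(1) by simp
  note eq = sum_minimal_imp_eq[OF fin ge \<open>q > 0\<close> le sum]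
  show ?case
  proof (cases k)
    case 0
    then show ?thesis using eq(1) X by simp
  next
    case (Suc k')
    have "A \<noteq> {}" using c by auto
    then obtain x p' where p: "p = x # p'" "x \<in> A" "p' \<in> permutations_of_set (A - {x})"
      using Suc.prems(6) by (auto simp: permutations_of_set_nonempty)
    let ?\<sigma> = "\<lambda>h. \<sigma> (f x # h)"
    have s: "f x \<noteq> \<sigma> []" "survives ?\<sigma> k' (map f p')"
      using Suc.prems(7) Suc p by (auto simp: survives_Suc_Cons)
    have "card {y \<in> A - {x}. f y = ?\<sigma> (take k' (map f p'))}
        - count_list (take k' (map f p')) (?\<sigma> (take k' (map f p'))) = M"
    proof (rule Suc.IH)
      show "fact (card (A - {x})) * miss_prob (card (A - {x})) M m = ?g x"
        using eq(2)[of x] p(2) s(1) by (simp only: card_Diff q_def) auto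
      show "card {y \<in> A - {x}. f y = i} \<le> M" for i
        by (rule card_values_Diff_le[OF Suc.prems(1,2)])
    qed (use Suc.prems(1,5) Suc p s card_Diff \<open>m + M \<le> c\<close> in auto)
    \<comment> \<open>If \<open>x\<close> has the value of the bid, removing it lowers the
      cardinality by 1, just as the head \<open>f x\<close> raises \<open>count_list\<close> by 1;
      the difference is the same for \<open>A\<close> and \<open>A - {x}\<close>.\<close>
    moreover have "{y \<in> A - {x}. f y = i} = {y \<in> A. f y = i} - (if f x = i then {x} else {})" for i
      by auto
    ultimately show ?thesis
      using Suc.prems(1) p(2) unfolding p(1) Suc by (auto split: if_splits)
  qed
qed

text \<open>Only cards of other values are turned before a hit, so the number of cards of value
  \<open>b\<close> stays fixed and the recursion holds with equality. Decided positions are covered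
  too.\<close>

lemma card_winning_orders_const:
  assumes "finite A" "m \<le> card A"
  shows "real (card (winning_orders f A m (\<lambda>_. b))) =
    fact (card A) * miss_prob (card A) (card {x\<in>A. f x = b}) m"
  using assms
proof (induction m arbitrary: A)
  case 0
  then show ?case by (simp add: card_winning_orders_0)
next
  case (Suc m)
  then obtain c where c: "card A = Suc c" by (cases "card A") auto
  let ?a = "card {x\<in>A. f x = b}"
  have "real (card (winning_orders f A (Suc m) (\<lambda>_. b))) =
      (\<Sum>x\<in>{x\<in>A. f x \<noteq> b}. real (card (winning_orders f (A - {x}) m (\<lambda>_. b))))"
    using Suc.prems c by (subst card_winning_orders_Suc) auto
  also have "\<dots> = (\<Sum>x\<in>{x\<in>A. f x \<noteq> b}. fact c * miss_prob c ?a m)"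
  proof (rule sum.cong)
    fix x assume x: "x \<in> {x\<in>A. f x \<noteq> b}"
    then have "card (A - {x}) = c" "{y\<in>A - {x}. f y = b} = {y\<in>A. f y = b}"
      using c Suc.prems(1) by auto
    then show "real (card (winning_orders f (A - {x}) m (\<lambda>_. b))) = fact c * miss_prob c ?a m"
      using Suc.IH[of "A - {x}"] Suc.prems c by simp
  qed simp
  also have "\<dots> = fact (card A) * miss_prob (card A) ?a (Suc m)"
    unfolding c fact_miss_prob_Suc using card_missing_values[OF Suc.prems(1), of f b] c by simp
  finally show ?case .
qed

section \<open>From counts of orders to the shuffled deck\<close>

lemma count_list_map_distinct:
  "distinct p \<Longrightarrow> count_list (map f p) i = card {x \<in> set p. f x = i}"
proof (induction p)
  case (Cons x p)
  have "{y \<in> set (x # p). f y = i} =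
      (if f x = i then insert x {y \<in> set p. f y = i} else {y \<in> set p. f y = i})"
    by auto
  with Cons show ?case by auto
qed simp

lemma finite_cards [simp]: "finite (cards v s)"
  by (simp add: cards_def)

lemma card_cards: "card (cards v s) = (\<Sum>i=1..v. s i)"
  by (simp add: cards_def)

lemma length_permutations_of_cards:
  "p \<in> permutations_of_set (cards v s) \<Longrightarrow> length p = (\<Sum>i=1..v. s i)"
  by (metis card_cards distinct_card permutations_of_setD)

lemma card_cards_value:
  "card {x \<in> cards v s. fst x = i} = (if i \<in> {1..v} then s i else 0)"
proof -
  have "{x \<in> cards v s. fst x = i} = (if i \<in> {1..v} then Pair i ` {..<s i} else {})"
    by (auto simp: cards_def)
  then show ?thesis by (simp add: card_image inj_on_def)
qed

lemma set_pmf_shuffled_deck: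
  "set_pmf (shuffled_deck v s) = map fst ` permutations_of_set (cards v s)"
  by (simp add: shuffled_deck_def)

lemma win_prob_eq:
  "win_prob v s m \<sigma> =
     real (card (winning_orders fst (cards v s) m \<sigma>)) / fact (\<Sum>i=1..v. s i)"
proof -
  have "permutations_of_set (cards v s) \<inter> map fst -` {d. survives \<sigma> m d}
      = winning_orders fst (cards v s) m \<sigma>"
    by (auto simp: winning_orders_def)
  then show ?thesis
    unfolding win_prob_def shuffled_deck_def
    by (simp add: measure_pmf_of_set card_cards)
qed

lemma win_prob_eq_iff:
  "win_prob v s m \<sigma> = r \<longleftrightarrow>
     fact (\<Sum>i=1..v. s i) * r = real (card (winning_orders fst (cards v s) m \<sigma>))"
  unfolding win_prob_eq by (auto simp: field_simps)

lemma mem_histories_iff: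
  "h \<in> histories v s m \<sigma> \<longleftrightarrow>
     (\<exists>k p. k \<le> m \<and> p \<in> permutations_of_set (cards v s) \<and> survives \<sigma> k (map fst p)
        \<and> h = take k (map fst p))"
  unfolding histories_def set_pmf_shuffled_deck by blast

section \<open>Maximal counts and remaining cards\<close>

lemma max_count_ge: "i \<in> {1..v} \<Longrightarrow> s i \<le> max_count v s"
  unfolding max_count_def by simp

lemma max_count_eqI:
  assumes "i \<in> {1..v}" "s i = M" "\<And>j. j \<in> {1..v} \<Longrightarrow> s j \<le> M"
  shows "max_count v s = M"
  unfolding max_count_def using assms by (intro Max_eqI) auto

lemma max_count_le_sum:
  assumes "v \<ge> 1"
  shows "max_count v s \<le> (\<Sum>i=1..v. s i)"
proof -
  have "max_count v s \<in> s ` {1..v}"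
    unfolding max_count_def using assms by (intro Max_in) auto
  then show ?thesis by (auto intro!: member_le_sum)
qed

lemma remaining_le: "remaining s h i \<le> s i"
  by (simp add: remaining_def)

text \<open>The cards of each value split between the turned part \<open>p\<close> and the rest
  \<open>q\<close>, so the truncated subtraction in \<open>remaining\<close> is exact here.\<close>

lemma card_remaining:
  assumes "p @ q \<in> permutations_of_set (cards v s)"
  shows "card {x \<in> set q. fst x = i} = (if i \<in> {1..v} then remaining s (map fst p) i else 0)"
proof -
  have pq: "distinct p" "distinct q" "set p \<inter> set q = {}" "set p \<union> set q = cards v s"
    using assms by (auto simp: permutations_of_set_def)
  have "card {x \<in> cards v s. fst x = i}
      = card ({x \<in> set p. fst x = i} \<union> {x \<in> set q. fst x = i})"
    using pq(4) by (auto intro: arg_cong[of _ _ card])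
  also have "\<dots> = card {x \<in> set p. fst x = i} + card {x \<in> set q. fst x = i}"
    using pq(3) by (intro card_Un_disjoint) auto
  finally show ?thesis
    using count_list_map_distinct[OF pq(1), of fst i]
    by (auto simp: card_cards_value remaining_def split: if_splits)
qed

section \<open>Sure losses and decided positions\<close>

text \<open>At an undecided position the lower bound, applied to the remaining cards and the
  continuation strategy, is positive. Hence some order \<open>q'\<close> of these cards survives the
  remaining rounds, and putting it after the turned cards gives a won deck.\<close>

lemma undecided_imp_not_surely_loses:
  assumes "v \<ge> 1" "h \<in> histories v s m \<sigma>" "m \<le> (\<Sum>i=1..v. s i)"
    and "\<not> decided v (remaining s h) (m - length h)"
  shows "\<not> surely_loses v s m \<sigma>"
proof -
  obtain k p where kp: "k \<le> m" "p \<in> permutations_of_set (cards v s)"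
      "survives \<sigma> k (map fst p)" "h = take k (map fst p)"
    using assms(2) unfolding mem_histories_iff by blast
  have "length p = (\<Sum>i=1..v. s i)"
    using length_permutations_of_cards[OF kp(2)] .
  then have len: "length h = k" "k \<le> length p" using kp assms(3) by auto
  define q where "q = drop k p"
  have p: "take k p @ q \<in> permutations_of_set (cards v s)"
    using kp(2) by (simp add: q_def)
  have h: "h = map fst (take k p)" using kp by (simp add: take_map)
  have card_q: "card {x \<in> set q. fst x = i} = (if i \<in> {1..v} then remaining s h i else 0)" for i
    unfolding h by (rule card_remaining[OF p])
  let ?M = "max_count v (remaining s h)"
  have "set q \<subseteq> cards v s"
    using permutations_of_setD(1)[OF p] by auto
  then have "fst ` set q \<subseteq> {1..v}"
    unfolding cards_def by auto
  then have "card (set q) = (\<Sum>i=1..v. card {x \<in> set q. fst x = i})"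
    using sum.group[of "set q" "{1..v}" fst "\<lambda>_. 1 :: nat"] by simp
  also have "\<dots> = (\<Sum>i=1..v. remaining s h i)"
    by (simp add: card_q)
  \<comment> \<open>Undecidedness is stated with truncated subtraction; since the maximum is at most
    the sum, it can be moved to the other side.\<close>
  finally have "m - k + ?M \<le> card (set q)"
    using assms(4) max_count_le_sum[OF assms(1), of "remaining s h"] len
    unfolding decided_def by simp
  moreover have "card {x \<in> set q. fst x = i} \<le> ?M" for i
    using max_count_ge[of i v "remaining s h"] by (simp add: card_q)
  ultimately have "0 < real (card (winning_orders fst (set q) (m - k) (\<lambda>h'. \<sigma> (h @ h'))))"
    using card_winning_orders_ge[of "set q" fst ?M "m - k"] miss_prob_pos[of "m - k" ?M "card (set q)"]
    by (smt (verit) List.finite_set fact_gt_zero mult_pos_pos)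
  then obtain q' where q': "q' \<in> permutations_of_set (set q)"
      "survives (\<lambda>h'. \<sigma> (h @ h')) (m - k) (map fst q')"
    unfolding winning_orders_def by (auto simp: card_gt_0_iff)
  have "survives \<sigma> (length h + (m - k)) (h @ map fst q')"
    unfolding survives_append using q' kp len by (simp add: survives_take)
  then have "survives \<sigma> m (map fst (take k p @ q'))"
    using kp len by (simp add: take_map)
  moreover have "take k p @ q' \<in> permutations_of_set (cards v s)"
  proof -
    have "distinct (take k p @ q)" "set (take k p @ q) = cards v s"
      using p by (auto simp: permutations_of_set_def)
    then show ?thesis using q'(1) by (auto simp: permutations_of_set_def)
  qed
  ultimately show ?thesis
    unfolding surely_loses_def set_pmf_shuffled_deck by blast
qed

lemma surely_loses_iff:
  assumes "v \<ge> 1" "m \<le> (\<Sum>i=1..v. s i)"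
  shows "surely_loses v s m \<sigma> \<longleftrightarrow> undecided_never_appears v s m \<sigma>"
proof
  show "undecided_never_appears v s m \<sigma>" if "surely_loses v s m \<sigma>"
    using undecided_imp_not_surely_loses[OF assms(1) _ assms(2)] that
    unfolding undecided_never_appears_def by blast
next
  assume never: "undecided_never_appears v s m \<sigma>"
  show "surely_loses v s m \<sigma>"
    unfolding surely_loses_def
  proof (intro ballI notI)
    fix d assume d: "d \<in> set_pmf (shuffled_deck v s)" "survives \<sigma> m d"
    have "length d = (\<Sum>i=1..v. s i)"
      using d(1) length_permutations_of_cards unfolding set_pmf_shuffled_deck by auto
    \<comment> \<open>A won play ends in a history with no round left, and 0 rounds never exceed
      anything, so this history is undecided.\<close>
    then have "length (take m d) = m" using assms(2) by simp
    moreover have "take m d \<in> histories v s m \<sigma>"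
      using d unfolding histories_def by blast
    ultimately show False
      using never unfolding undecided_never_appears_def decided_def by fastforce
  qed
qed

section \<open>Anti-greedy play\<close>

lemma remaining_snoc:
  "remaining s (h @ [x]) i = remaining s h i - (if x = i then 1 else 0)"
  by (simp add: remaining_def)

text \<open>
  The bid is a most frequent remaining value and the turned card misses it, so the maximum does
  not change while the play goes on.
\<close>

lemma max_count_remaining_anti_greedy:
  assumes "\<sigma> \<in> strategies v" "anti_greedy v s m \<sigma>" "h \<in> histories v s m \<sigma>"
  shows "max_count v (remaining s h) = max_count v s"
proof -
  obtain k p where kp: "k \<le> m" "p \<in> permutations_of_set (cards v s)"
      "survives \<sigma> k (map fst p)" "h = take k (map fst p)"
    using assms(3) unfolding mem_histories_iff by blast
  have "j \<le> k \<Longrightarrow> max_count v (remaining s (take j (map fst p))) = max_count v s" for j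
  proof (induction j)
    case 0
    show ?case by (simp add: remaining_def)
  next
    case (Suc j)
    let ?h = "take j (map fst p)"
    show ?case
    \<comment> \<open>\<open>k\<close> may exceed the deck size; past the end of \<open>p\<close>
      the prefix no longer changes.\<close>
    proof (cases "j < length p")
      case True
      then have step: "take (Suc j) (map fst p) = ?h @ [map fst p ! j]"
        by (simp add: take_Suc_conv_app_nth)
      have miss: "map fst p ! j \<noteq> \<sigma> ?h"
        using kp(3) Suc.prems unfolding survives_def by auto
      have "?h \<in> histories v s m \<sigma>"
        unfolding mem_histories_iff using kp Suc.prems survives_mono[OF kp(3), of j]
        by (intro exI[of _ j] exI[of _ p]) auto
      then have bid: "remaining s ?h (\<sigma> ?h) = max_count v s"
        using assms(2) Suc kp(1) True unfolding anti_greedy_def by auto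
      show ?thesis
      proof (rule max_count_eqI)
        show "\<sigma> ?h \<in> {1..v}" using assms(1) unfolding strategies_def by blast
        show "remaining s (take (Suc j) (map fst p)) (\<sigma> ?h) = max_count v s"
          using bid miss unfolding step remaining_snoc by simp
        show "remaining s (take (Suc j) (map fst p)) i \<le> max_count v s" if "i \<in> {1..v}" for i
          using max_count_ge[OF that, of s] remaining_le[of s _ i] le_trans by blast
      qed
    next
      case False
      then show ?thesis using Suc by simp
    qed
  qed
  then show ?thesis using kp(4) by blast
qed

text \<open>Forward, the maximum is constant along the play. Backward, no remaining count exceeds
  the initial maximum, so a bid that reaches it is a most frequent value.\<close>

lemma anti_greedy_iff:
  assumes "\<sigma> \<in> strategies v"
  shows "anti_greedy v s m \<sigma> \<longleftrightarrow>
    (\<forall>h\<in>histories v s m \<sigma>. length h < m \<longrightarrow> remaining s h (\<sigma> h) = max_count v s)"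
proof
  show "\<forall>h\<in>histories v s m \<sigma>. length h < m \<longrightarrow> remaining s h (\<sigma> h) = max_count v s"
    if "anti_greedy v s m \<sigma>"
    using that max_count_remaining_anti_greedy[OF assms that] unfolding anti_greedy_def by simp
next
  assume max: "\<forall>h\<in>histories v s m \<sigma>. length h < m \<longrightarrow> remaining s h (\<sigma> h) = max_count v s"
  show "anti_greedy v s m \<sigma>"
    unfolding anti_greedy_def
  proof (intro ballI impI)
    fix h assume h: "h \<in> histories v s m \<sigma>" "length h < m"
    have "max_count v (remaining s h) = max_count v s"
    proof (rule max_count_eqI)
      show "\<sigma> h \<in> {1..v}" using assms unfolding strategies_def by blast
      show "remaining s h (\<sigma> h) = max_count v s" using max h by blast
      show "remaining s h i \<le> max_count v s" if "i \<in> {1..v}" for i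
        using max_count_ge[OF that, of s] remaining_le[of s h i] by simp
    qed
    then show "remaining s h (\<sigma> h) = max_count v (remaining s h)" using max h by simp
  qed
qed

section \<open>The minimum and the strategies attaining it\<close>

lemma win_prob_ge:
  assumes "m + max_count v s \<le> (\<Sum>i=1..v. s i)"
  shows "miss_prob (\<Sum>i=1..v. s i) (max_count v s) m \<le> win_prob v s m \<sigma>"
proof -
  have "card {x \<in> cards v s. fst x = i} \<le> max_count v s" for i
    using max_count_ge[of i v s] by (simp add: card_cards_value)
  then show ?thesis
    using card_winning_orders_ge[of "cards v s" fst "max_count v s" m \<sigma>] assms
    unfolding win_prob_eq card_cards by (simp add: field_simps)
qed

lemma win_prob_const:
  assumes "b \<in> {1..v}" "m \<le> (\<Sum>i=1..v. s i)"
  shows "win_prob v s m (\<lambda>_. b) = miss_prob (\<Sum>i=1..v. s i) (s b) m"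
  using card_winning_orders_const[of "cards v s" m fst b] assms
  unfolding win_prob_eq_iff card_cards card_cards_value by simp

lemma win_prob_minimal_imp_anti_greedy:
  assumes "\<sigma> \<in> strategies v" "m + max_count v s \<le> (\<Sum>i=1..v. s i)"
    and "win_prob v s m \<sigma> = miss_prob (\<Sum>i=1..v. s i) (max_count v s) m"
  shows "anti_greedy v s m \<sigma>"
  unfolding anti_greedy_iff[OF assms(1)]
proof (intro ballI impI)
  fix h assume "h \<in> histories v s m \<sigma>" and len: "length h < m"
  then obtain k p where kp: "k \<le> m" "p \<in> permutations_of_set (cards v s)"
      "survives \<sigma> k (map fst p)" "h = take k (map fst p)"
    unfolding mem_histories_iff by blast
  have "length p = (\<Sum>i=1..v. s i)"
    using length_permutations_of_cards[OF kp(2)] .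
  \<comment> \<open>The deck has at least \<open>m\<close> cards, so \<open>take k\<close> is not
    cut short and \<open>h\<close> has length \<open>k\<close>.\<close>
  then have "k < m" using kp len assms(2) by auto
  have le: "card {x \<in> cards v s. fst x = i} \<le> max_count v s" for i
    using max_count_ge[of i v s] by (simp add: card_cards_value)
  have "card {x \<in> cards v s. fst x = \<sigma> h} - count_list h (\<sigma> h) = max_count v s"
    unfolding kp(4)
    by (rule card_winning_orders_eq_imp_bid[OF _ le _ _ \<open>k < m\<close> kp(2,3)])
      (use assms(2,3) in \<open>auto simp: card_cards win_prob_eq_iff\<close>)
  moreover have "\<sigma> h \<in> {1..v}" using assms(1) unfolding strategies_def by blast
  ultimately show "remaining s h (\<sigma> h) = max_count v s"
    by (simp add: card_cards_value remaining_def)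
qed

theorem theorem1p3:
  fixes v m c :: nat and s :: "nat \<Rightarrow> nat"
  assumes "v \<ge> 2"
    and "\<And>i j. 1 \<le> i \<Longrightarrow> i \<le> j \<Longrightarrow> j \<le> v \<Longrightarrow> s j \<le> s i"
    and "s v \<ge> 1"
    and "c = (\<Sum>i=1..v. s i)"
    and "m \<le> c"
  shows "(is_min_win_prob v s m 0 \<longleftrightarrow> decided v s m)
    \<and> (decided v s m \<longleftrightarrow> m > c - s 1)
    \<and> (\<forall>\<sigma>\<in>strategies v. surely_loses v s m \<sigma> \<longleftrightarrow> undecided_never_appears v s m \<sigma>)
    \<and> (m \<le> c - s 1 \<longrightarrow>
         is_min_win_prob v s m (\<Prod>i<m. (real c - real (s 1) - real i) / (real c - real i))
         \<and> (\<forall>\<sigma>\<in>strategies v.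
              win_prob v s m \<sigma> = (\<Prod>i<m. (real c - real (s 1) - real i) / (real c - real i))
              \<longrightarrow> anti_greedy v s m \<sigma>)
         \<and> (\<forall>\<sigma>\<in>strategies v. anti_greedy v s m \<sigma> \<longleftrightarrow>
              (\<forall>h\<in>histories v s m \<sigma>. length h < m \<longrightarrow> remaining s h (\<sigma> h) = s 1)))"
proof -
  have max: "max_count v s = s 1"
    using assms(1,2) by (intro max_count_eqI[of 1]) auto
  have s1: "s 1 \<le> c"
    using max_count_le_sum[of v s] assms(1,4) max by simp
  have dec: "decided v s m \<longleftrightarrow> m > c - s 1"
    unfolding decided_def max assms(4) ..
  \<comment> \<open>Always bidding Value 1, a most frequent one initially, is the witness for both
    minima: the product, and 0 in decided positions, where the product vanishes.\<close>
  have const: "(\<lambda>_. 1) \<in> strategies v" "win_prob v s m (\<lambda>_. 1) = miss_prob c (s 1) m"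
    using win_prob_const[of 1 v m s] assms(1,4,5) by (auto simp: strategies_def)
  have ge: "miss_prob c (s 1) m \<le> win_prob v s m \<sigma>" if "m \<le> c - s 1" for \<sigma>
    using win_prob_ge[of m v s \<sigma>] that s1 unfolding max assms(4) by simp
  have "is_min_win_prob v s m 0 \<longleftrightarrow> decided v s m"
  proof
    assume zero: "is_min_win_prob v s m 0"
    show "decided v s m"
    proof (rule ccontr)
      assume "\<not> decided v s m"
      then have "m \<le> c - s 1" unfolding dec by simp
      moreover from this have "miss_prob c (s 1) m > 0" using s1 by (intro miss_prob_pos) simp
      ultimately show False using zero ge unfolding is_min_win_prob_def by (metis not_less)
    qed
  next
    assume "decided v s m"
    then have "win_prob v s m (\<lambda>_. 1) = 0"
      using const(2) miss_prob_eq_0[OF s1] dec by simp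
    then show "is_min_win_prob v s m 0"
      unfolding is_min_win_prob_def using const(1) by (auto simp: win_prob_def)
  qed
  moreover have "surely_loses v s m \<sigma> \<longleftrightarrow> undecided_never_appears v s m \<sigma>" for \<sigma>
    using assms by (intro surely_loses_iff) auto
  moreover have "is_min_win_prob v s m (miss_prob c (s 1) m)" if "m \<le> c - s 1"
    unfolding is_min_win_prob_def using const ge[OF that] by blast
  moreover have "anti_greedy v s m \<sigma>"
    if "m \<le> c - s 1" "\<sigma> \<in> strategies v" "win_prob v s m \<sigma> = miss_prob c (s 1) m" for \<sigma>
    using win_prob_minimal_imp_anti_greedy[of \<sigma> v m s] that s1 unfolding max assms(4) by simp
  ultimately show ?thesis
    using dec anti_greedy_iff[of _ v s m] unfolding max miss_prob_def by blast
qed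

end
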